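(* Let $k\ge1$, let $H$ be a $k$-weakly-partition-connected labelled multihypergraph, and let $G$ be any tree assignment of $H$. Then $G$ contains $k$ pairwise edge-disjoint spanning trees. If, in addition, $H$ is $k$-critical, those trees exhaust $E(G)$ and hence form an ordered $k$-tree decomposition of $G$ after an arbitrary ordering.
   Context: A labelled multihypergraph $H=(V,E)$ has a finite vertex set $V$ with $|V|\ge 2$ and a finite set $E$ of hyperedge occurrences, each with a support that is a subset of $V$ of cardinality at least $2$ (standing assumptions); distinct occurrences may have the same support and remain distinct. We write $e$ both for the occurrence and its support. For a partition $\mathcal P$ of $V$ let $p_{\mathcal P}(e)$ be the number of blocks of $\mathcal P$ met by $e$, and $w_H(\mathcal P)=\sum_{e\in E}(p_{\mathcal P}(e)-1)$. $H$ is $k$-weakly-partition-connected if $w_H(\mathcal P)\ge k(|\mathcal P|-1)$ for every partition $\mathcal P$ of $V$. With $\rho(H)=\sum_{e\in E}(|e|-1)$, $H$ is $k$-critical if $\rho(H)=k(|V|-1)$. A tree assignment of $H$ chooses, for every $e\in E$, a simple tree $F_e$ with vertex set $e$ and labels every edge of $F_e$ by $e$; the assigned graph is the labelled multigraph $G=\biguplus_{e\in E}F_e$ on $V$ (disjoint union of labelled edge occurrences; parallel edges may arise only from distinct labels). Edge-disjointness refers to labelled edge occurrences. An ordered $k$-tree decomposition of $G$ is an ordered partition $E(G)=E(T_0)\,\dot\cup\,\cdots\,\dot\cup\,E(T_{k-1})$ of all edge occurrences in which every $T_i$ is a spanning tree of $V$ (containing no parallel pair). *)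

theory Defs
  imports Main "HOL-Library.Disjoint_Sets"
begin

section \<open>Labelled multihypergraphs\<close>

text \<open>
  Elements of \<open>hedges H\<close> are hyperedge occurrences (labels); \<open>support H\<close> need not be
  injective on them.
\<close>

record ('v, 'e) multihypergraph =
  verts :: "'v set"
  hedges :: "'e set"
  support :: "'e \<Rightarrow> 'v set"

locale labelled_multihypergraph =
  fixes H :: "('v, 'e) multihypergraph"
  assumes finite_verts: "finite (verts H)"
    and two_le_card_verts: "2 \<le> card (verts H)"
    and finite_hedges: "finite (hedges H)"
    and support_subset: "e \<in> hedges H \<Longrightarrow> support H e \<subseteq> verts H"
    and two_le_card_support: "e \<in> hedges H \<Longrightarrow> 2 \<le> card (support H e)"

definition blocks_met :: "('v, 'e) multihypergraph \<Rightarrow> 'v set set \<Rightarrow> 'e \<Rightarrow> nat" where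
  "blocks_met H P e = card {B \<in> P. B \<inter> support H e \<noteq> {}}"

text \<open>
  The truncated natural-number subtractions below are harmless: supports, vertex sets and
  partitions of the latter are nonempty and finite in a labelled multihypergraph.
\<close>

definition partition_weight :: "('v, 'e) multihypergraph \<Rightarrow> 'v set set \<Rightarrow> nat" where
  "partition_weight H P = (\<Sum>e\<in>hedges H. blocks_met H P e - 1)"

definition weakly_partition_connected :: "nat \<Rightarrow> ('v, 'e) multihypergraph \<Rightarrow> bool" where
  "weakly_partition_connected k H \<longleftrightarrow>
     (\<forall>P. partition_on (verts H) P \<longrightarrow> k * (card P - 1) \<le> partition_weight H P)"

definition rho :: "('v, 'e) multihypergraph \<Rightarrow> nat" where
  "rho H = (\<Sum>e\<in>hedges H. card (support H e) - 1)"

definition critical :: "nat \<Rightarrow> ('v, 'e) multihypergraph \<Rightarrow> bool" where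
  "critical k H \<longleftrightarrow> rho H = k * (card (verts H) - 1)"


section \<open>Simple trees\<close>

text \<open>
  A simple graph on a vertex set \<open>V\<close> is given by its edge set \<open>F\<close>, a set of two-element
  subsets of \<open>V\<close>.
\<close>

definition simple_graph :: "'v set \<Rightarrow> 'v set set \<Rightarrow> bool" where
  "simple_graph V F \<longleftrightarrow> (\<forall>f\<in>F. f \<subseteq> V \<and> card f = 2)"

definition connected_graph :: "'v set \<Rightarrow> 'v set set \<Rightarrow> bool" where
  "connected_graph V F \<longleftrightarrow>
     V \<noteq> {} \<and> (\<forall>u\<in>V. \<forall>v\<in>V. (u, v) \<in> {(x, y). {x, y} \<in> F}\<^sup>*)"

text \<open>A cycle is listed without repeating its first vertex at the end.\<close>

definition graph_cycle :: "'v set set \<Rightarrow> 'v list \<Rightarrow> bool" where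
  "graph_cycle F c \<longleftrightarrow> 3 \<le> length c \<and> distinct c \<and>
     (\<forall>i<length c. {c ! i, c ! (Suc i mod length c)} \<in> F)"

definition simple_tree :: "'v set \<Rightarrow> 'v set set \<Rightarrow> bool" where
  "simple_tree V F \<longleftrightarrow>
     simple_graph V F \<and> connected_graph V F \<and> (\<nexists>c. graph_cycle F c)"


section \<open>Tree assignments and spanning trees\<close>

definition tree_assignment ::
    "('v, 'e) multihypergraph \<Rightarrow> ('e \<Rightarrow> 'v set set) \<Rightarrow> bool" where
  "tree_assignment H F \<longleftrightarrow> (\<forall>e\<in>hedges H. simple_tree (support H e) (F e))"

text \<open>
  An edge occurrence is a pair \<open>(e, f)\<close> of a label \<open>e\<close> and its pair of endpoints \<open>f\<close>; a
  labelled multigraph on a known vertex set is its set of edge occurrences. The dependent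
  sum is thus the disjoint union of the trees \<open>F e\<close>, with every edge of \<open>F e\<close> labelled \<open>e\<close>.
\<close>

definition assigned_graph ::
    "('v, 'e) multihypergraph \<Rightarrow> ('e \<Rightarrow> 'v set set) \<Rightarrow> ('e \<times> 'v set) set" where
  "assigned_graph H F = (SIGMA e:hedges H. F e)"

text \<open>Injectivity of \<^const>\<open>snd\<close> says that there is no parallel pair.\<close>

definition spanning_tree ::
    "'v set \<Rightarrow> ('e \<times> 'v set) set \<Rightarrow> ('e \<times> 'v set) set \<Rightarrow> bool" where
  "spanning_tree V G T \<longleftrightarrow> T \<subseteq> G \<and> inj_on snd T \<and> simple_tree V (snd ` T)"

definition spanning_tree_packing ::
    "nat \<Rightarrow> 'v set \<Rightarrow> ('e \<times> 'v set) set \<Rightarrow> ('e \<times> 'v set) set set \<Rightarrow> bool" where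
  "spanning_tree_packing k V G \<T> \<longleftrightarrow>
     finite \<T> \<and> card \<T> = k \<and> (\<forall>T\<in>\<T>. spanning_tree V G T) \<and> disjoint \<T>"

definition ordered_tree_decomposition ::
    "nat \<Rightarrow> 'v set \<Rightarrow> ('e \<times> 'v set) set \<Rightarrow> (nat \<Rightarrow> ('e \<times> 'v set) set) \<Rightarrow> bool" where
  "ordered_tree_decomposition k V G T \<longleftrightarrow>
     (\<forall>i<k. spanning_tree V G (T i)) \<and> disjoint_family_on T {..<k} \<and> (\<Union>i<k. T i) = G"

end

theory Submission
  imports Defs
begin

text \<open>
  The theorem reduces to the Nash-Williams--Tutte criterion for packing spanning trees in a
  multigraph. If a partition \<open>P\<close> of the vertices meets a hyperedge \<open>e\<close> in \<open>p\<close> blocks, then any tree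
  on \<open>e\<close> needs at least \<open>p - 1\<close> edges between different blocks (\<open>card_crossing_edges_ge\<close>).
  Summation over the hyperedges turns weak partition connectivity into the statement that at least
  \<open>k(|P| - 1)\<close> edges of the assigned graph cross every partition \<open>P\<close>, which is the hypothesis of
  \<open>tree_packing\<close>. If the hypergraph is critical, the assigned graph has \<open>k(|V| - 1)\<close> edges in all,
  just as many as \<open>k\<close> disjoint spanning trees need, so nothing is left over.

  The packing criterion is proved through the cycle matroid, given by its closure operator: an edge
  is spanned by a set of edges if its ends are joined in that set. For any matroid, a maximum
  packing of \<open>k\<close> independent sets comes with a set \<open>S\<close> that contains all uncovered elements and is
  spanned by its intersection with each member of the packing
  (\<open>exists_packing_with_tight_set\<close>). In a multigraph the components of \<open>S\<close> form a partition that
  is crossed only by covered edges. Counting these edges shows that, unless all \<open>k\<close> forests are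
  spanning trees, there are fewer than \<open>k(|P| - 1)\<close> of them.
\<close>

section \<open>Packing independent sets of an exchange closure\<close>

text \<open>
  On a finite type these are exactly the closure operators of matroids. The ground set is not part
  of the structure; it enters below as the finite set from which a packing is chosen.
\<close>

locale exchange_closure =
  fixes cl :: "'a set \<Rightarrow> 'a set"
  assumes extensive: "A \<subseteq> cl A"
    and transitive: "A \<subseteq> cl B \<Longrightarrow> cl A \<subseteq> cl B"
    and exchange: "e \<in> cl (insert f A) \<Longrightarrow> e \<notin> cl A \<Longrightarrow> f \<in> cl (insert e A)"
begin

lemma cl_mono: "A \<subseteq> B \<Longrightarrow> cl A \<subseteq> cl B"
  using extensive transitive by (meson subset_trans)

definition indep :: "'a set \<Rightarrow> bool" where
  "indep A \<longleftrightarrow> (\<forall>e\<in>A. e \<notin> cl (A - {e}))"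

lemma indep_subset: "indep B \<Longrightarrow> A \<subseteq> B \<Longrightarrow> indep A"
  unfolding indep_def using cl_mono by (meson Diff_mono subset_eq subset_refl)

lemma indep_insert:
  assumes "indep A" and "e \<notin> cl A"
  shows "indep (insert e A)"
  unfolding indep_def
proof (intro ballI notI)
  fix g assume g: "g \<in> insert e A" and dep: "g \<in> cl (insert e A - {g})"
  have "e \<notin> A"
    using assms(2) extensive by blast
  show False
  proof (cases "g = e")
    case True
    then show False
      using dep assms(2) \<open>e \<notin> A\<close> by simp
  next
    case False
    then have "g \<in> A" and eq: "insert e A - {g} = insert e (A - {g})"
      using g by auto
    moreover have "g \<notin> cl (A - {g})"
      using assms(1) \<open>g \<in> A\<close> by (auto simp: indep_def)
    ultimately have "e \<in> cl (insert g (A - {g}))"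
      using dep exchange by metis
    then show False
      using assms(2) \<open>g \<in> A\<close> by (simp add: insert_absorb)
  qed
qed

text \<open>
  The set in the conclusion is the fundamental circuit of \<open>e\<close> with respect to \<open>I\<close>, without \<open>e\<close>: a
  minimal subset of \<open>I\<close> spanning \<open>e\<close> can contain no \<open>f\<close> that is dispensable in \<open>I\<close>, since
  exchanging \<open>e\<close> with \<open>f\<close> would place \<open>f\<close> in the closure of the rest of \<open>I\<close>.
\<close>

lemma spanned_by_fundamental_circuit:
  assumes "finite I" and "indep I" and "e \<in> cl I"
  shows "e \<in> cl {f \<in> I. e \<notin> cl (I - {f})}"
proof -
  obtain C where C: "C \<subseteq> I" "e \<in> cl C"
    and min: "\<And>D. D \<subseteq> I \<Longrightarrow> e \<in> cl D \<Longrightarrow> card C \<le> card D"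
    using assms(3) ex_has_least_nat[of "\<lambda>C. C \<subseteq> I \<and> e \<in> cl C" I card] by blast
  have "e \<notin> cl (I - {f})" if f: "f \<in> C" for f
  proof
    assume e: "e \<in> cl (I - {f})"
    have "card (C - {f}) < card C"
      using f C(1) assms(1) by (meson card_Diff1_less finite_subset)
    then have "e \<notin> cl (C - {f})"
      using min[of "C - {f}"] C(1) by auto
    then have "f \<in> cl (insert e (C - {f}))"
      using exchange[of e f "C - {f}"] C(2) f by (simp add: insert_absorb)
    moreover have "insert e (C - {f}) \<subseteq> cl (I - {f})"
      using e C(1) extensive[of "I - {f}"] by auto
    ultimately have "f \<in> cl (I - {f})"
      using transitive by blast
    then show False
      using assms(2) f C(1) by (auto simp: indep_def)
  qed
  then have "C \<subseteq> {f \<in> I. e \<notin> cl (I - {f})}"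
    using C(1) by blast
  then show ?thesis
    using C(2) cl_mono by blast
qed

lemma cl_swap_eq:
  assumes "f \<in> J" and "e \<in> cl J" and "e \<notin> cl (J - {f})"
  shows "cl (insert e (J - {f})) = cl J"
proof
  show "cl (insert e (J - {f})) \<subseteq> cl J"
    using assms(2) extensive[of J] by (intro transitive) auto
  have "f \<in> cl (insert e (J - {f}))"
    using assms exchange[of e f "J - {f}"] by (simp add: insert_absorb)
  then show "cl J \<subseteq> cl (insert e (J - {f}))"
    using extensive[of "insert e (J - {f})"] by (intro transitive) auto
qed

definition indep_packing :: "nat \<Rightarrow> 'a set \<Rightarrow> (nat \<Rightarrow> 'a set) \<Rightarrow> bool" where
  "indep_packing k E I \<longleftrightarrow>
     (\<forall>i<k. I i \<subseteq> E \<and> indep (I i)) \<and> disjoint_family_on I {..<k}"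

text \<open>
  If \<open>I i\<close> spans \<open>e\<close>, the closure condition says that \<open>f\<close> lies on the fundamental circuit of \<open>e\<close>.
\<close>

definition swap_step :: "nat \<Rightarrow> 'a set \<Rightarrow> (nat \<Rightarrow> 'a set) \<Rightarrow> (nat \<Rightarrow> 'a set) \<Rightarrow> bool" where
  "swap_step k E I I' \<longleftrightarrow>
     (\<exists>i<k. \<exists>e \<in> E - (\<Union>j<k. I j). \<exists>f \<in> I i.
        e \<notin> cl (I i - {f}) \<and> I' = I(i := insert e (I i - {f})))"

lemma indep_packing_update:
  assumes I: "indep_packing k E I" and e: "e \<in> E - (\<Union>j<k. I j)"
    and J: "J \<subseteq> I i" and i: "i < k" and "e \<notin> cl J"
  shows "indep_packing k E (I(i := insert e J))"
proof -
  have "I i \<subseteq> E" and "indep (I i)"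
    using I i by (simp_all add: indep_packing_def)
  then have "indep (insert e J)" and "insert e J \<subseteq> E"
    using J e \<open>e \<notin> cl J\<close> indep_insert[of J e] indep_subset[of "I i" J] by auto
  moreover have disj: "insert e J \<inter> I j = {}" if "j < k" "j \<noteq> i" for j
  proof -
    have "I i \<inter> I j = {}"
      using I i that unfolding indep_packing_def disjoint_family_on_def by simp
    then show ?thesis
      using e J that(1) by auto
  qed
  moreover have "(I(i := insert e J)) m \<inter> (I(i := insert e J)) n = {}"
    if "m < k" "n < k" "m \<noteq> n" for m n
  proof (cases "m = i \<or> n = i")
    case True
    then show ?thesis
      using disj[of m] disj[of n] that by (auto simp: Int_commute)
  next
    case False
    then show ?thesis
      using I that by (simp add: indep_packing_def disjoint_family_on_def)
  qed
  ultimately show ?thesis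
    using I by (simp add: indep_packing_def disjoint_family_on_def)
qed

lemma finite_packing_member: "indep_packing k E I \<Longrightarrow> i < k \<Longrightarrow> finite E \<Longrightarrow> finite (I i)"
  unfolding indep_packing_def using finite_subset by blast

lemma sum_card_update:
  fixes k :: nat
  assumes "i < k"
  shows "(\<Sum>j<k. card ((I(i := J)) j)) + card (I i) = (\<Sum>j<k. card (I j)) + card J"
proof -
  have "(\<Sum>j<k. card ((I(i := J)) j)) = card J + (\<Sum>j\<in>{..<k} - {i}. card (I j))"
    using assms by (subst sum.remove[of _ i]) (auto intro!: sum.cong)
  moreover have "(\<Sum>j<k. card (I j)) = card (I i) + (\<Sum>j\<in>{..<k} - {i}. card (I j))"
    using assms by (subst sum.remove[of _ i]) auto
  ultimately show ?thesis
    by simp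
qed

lemma swapped_out_uncovered:
  assumes I: "indep_packing k E I" and e: "e \<in> E - (\<Union>j<k. I j)" and i: "i < k" and f: "f \<in> I i"
  shows "f \<in> E - (\<Union>j<k. (I(i := insert e (I i - {f}))) j)"
proof -
  have "f \<in> E"
    using I i f unfolding indep_packing_def by blast
  moreover have "f \<notin> (I(i := insert e (I i - {f}))) j" if "j < k" for j
  proof (cases "j = i")
    case True
    then show ?thesis
      using e i f by auto
  next
    case False
    then have "I i \<inter> I j = {}"
      using I i that unfolding indep_packing_def disjoint_family_on_def by simp
    then show ?thesis
      using f False by auto
  qed
  ultimately show ?thesis
    by blast
qed

lemma swap_step_preserves:
  assumes "finite E" and "indep_packing k E I" and "swap_step k E I I'"
  shows "indep_packing k E I'" and "(\<Sum>j<k. card (I' j)) = (\<Sum>j<k. card (I j))"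
proof -
  obtain i e f where i: "i < k" and e: "e \<in> E - (\<Union>j<k. I j)" and f: "f \<in> I i"
    and ne: "e \<notin> cl (I i - {f})" and I': "I' = I(i := insert e (I i - {f}))"
    using assms(3) unfolding swap_step_def by blast
  show "indep_packing k E I'"
    unfolding I' using ne by (rule indep_packing_update[OF assms(2) e Diff_subset i])
  have "finite (I i)"
    using assms(2) i assms(1) by (rule finite_packing_member)
  moreover have "e \<notin> I i"
    using e i by blast
  ultimately have "card (insert e (I i - {f})) = card (I i)"
    using f by (metis card_Suc_Diff1 card_insert_disjoint DiffD1 finite_Diff)
  then show "(\<Sum>j<k. card (I' j)) = (\<Sum>j<k. card (I j))"
    using sum_card_update[OF i, of I "insert e (I i - {f})"] unfolding I' by linarith
qed

text \<open>
  Start from a packing of maximum total size and let \<open>S\<close> collect every element that is left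
  uncovered by some packing reachable by swaps. By maximality
  an uncovered element \<open>e\<close> is spanned by every member \<open>I i\<close>, and each member of its fundamental
  circuit can be swapped out, so the circuit lies in \<open>S\<close>; thus \<open>e\<close> is spanned already by
  \<open>I i \<inter> S\<close>. Hence a swap does not alter the closure of \<open>I i \<inter> S\<close>. This closure is therefore the
  same for all reachable packings, and it contains everything that any of them leaves uncovered,
  that is, all of \<open>S\<close>. Comparing closures along the swaps takes the place of an analysis of
  shortest augmenting paths.
\<close>

theorem exists_packing_with_tight_set:
  assumes fin: "finite E"
  obtains I S where "indep_packing k E I" and "S \<subseteq> E" and "E - (\<Union>i<k. I i) \<subseteq> S"
    and "\<And>i. i < k \<Longrightarrow> S \<subseteq> cl (I i \<inter> S)"
proof -
  have "indep_packing k E (\<lambda>_. {})"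
    by (simp add: indep_packing_def indep_def disjoint_family_on_def)
  moreover have "(\<Sum>j<k. card (I j)) \<le> k * card E" if "indep_packing k E I" for I
  proof -
    have "card (I j) \<le> card E" if "j \<in> {..<k}" for j
      using \<open>indep_packing k E I\<close> that fin by (auto simp: indep_packing_def intro: card_mono)
    then have "(\<Sum>j<k. card (I j)) \<le> of_nat (card {..<k}) * card E"
      by (rule sum_bounded_above)
    then show ?thesis
      by simp
  qed
  ultimately obtain I0 where I0: "indep_packing k E I0"
    and max: "\<And>I. indep_packing k E I \<Longrightarrow> (\<Sum>j<k. card (I j)) \<le> (\<Sum>j<k. card (I0 j))"
    using ex_has_greatest_nat[of "indep_packing k E" "\<lambda>_. {}"
        "\<lambda>I. \<Sum>j<k. card (I j)" "Suc (k * card E)"]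
    unfolding less_Suc_eq_le by blast
  define R where "R = (swap_step k E)\<^sup>*\<^sup>* I0"
  have R: "indep_packing k E I \<and> (\<Sum>j<k. card (I j)) = (\<Sum>j<k. card (I0 j))" if "R I" for I
    using that unfolding R_def
  proof (induction rule: rtranclp_induct)
    case base
    then show ?case using I0 by simp
  next
    case (step I I')
    then show ?case using swap_step_preserves[OF fin, of k I I'] by simp
  qed
  define S where "S = (\<Union>I\<in>Collect R. E - (\<Union>j<k. I j))"
  have spanned: "e \<in> cl (I i)" if "R I" "e \<in> E - (\<Union>j<k. I j)" "i < k" for I e i
  proof (rule ccontr)
    assume "e \<notin> cl (I i)"
    then have "indep_packing k E (I(i := insert e (I i)))"
      using R[OF that(1)] that(2,3) by (intro indep_packing_update) auto
    from max[OF this] have "card (insert e (I i)) \<le> card (I i)"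
      using sum_card_update[OF that(3), of I "insert e (I i)"] R[OF that(1)] by linarith
    moreover have "finite (I i)"
      using R[OF that(1)] that(3) fin by (blast intro: finite_packing_member)
    moreover have "e \<notin> I i"
      using that(2,3) by blast
    ultimately show False
      by simp
  qed
  have circuit: "e \<in> cl (I i \<inter> S)" if RI: "R I" and e: "e \<in> E - (\<Union>j<k. I j)" and i: "i < k"
    for I e i
  proof -
    have I: "indep_packing k E I"
      using R RI by blast
    have "f \<in> S" if f: "f \<in> I i" "e \<notin> cl (I i - {f})" for f
    proof -
      let ?I' = "I(i := insert e (I i - {f}))"
      have "swap_step k E I ?I'"
        using e i f unfolding swap_step_def by blast
      then have "R ?I'"
        using RI unfolding R_def by (rule rtranclp.rtrancl_into_rtrancl[rotated])
      moreover have "f \<in> E - (\<Union>j<k. ?I' j)"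
        using I e i f(1) by (rule swapped_out_uncovered)
      ultimately show "f \<in> S"
        unfolding S_def by blast
    qed
    then have "{f \<in> I i. e \<notin> cl (I i - {f})} \<subseteq> I i \<inter> S"
      by blast
    moreover have "e \<in> cl {f \<in> I i. e \<notin> cl (I i - {f})}"
    proof (rule spanned_by_fundamental_circuit)
      show "finite (I i)"
        using I i fin by (rule finite_packing_member)
      show "indep (I i)"
        using I i by (simp add: indep_packing_def)
      show "e \<in> cl (I i)"
        using RI e i by (rule spanned)
    qed
    ultimately show ?thesis
      using cl_mono by blast
  qed
  have invariant: "\<forall>i<k. cl (I i \<inter> S) = cl (I0 i \<inter> S)" if "R I" for I
    using that unfolding R_def
  proof (induction rule: rtranclp_induct)
    case base
    then show ?case by simp
  next
    case (step I I')
    have RI: "R I" and RI': "R I'"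
      using step.hyps unfolding R_def by auto
    obtain i e f where i: "i < k" and e: "e \<in> E - (\<Union>j<k. I j)" and f: "f \<in> I i"
      and ne: "e \<notin> cl (I i - {f})" and I': "I' = I(i := insert e (I i - {f}))"
      using step.hyps(2) unfolding swap_step_def by blast
    have eS: "e \<in> S"
      using e RI unfolding S_def by blast
    have "f \<in> E - (\<Union>j<k. I' j)"
      using R[OF RI] f e i unfolding I' by (intro swapped_out_uncovered) auto
    then have fS: "f \<in> S"
      using RI' unfolding S_def by blast
    have eq: "insert e (I i - {f}) \<inter> S = insert e (I i \<inter> S - {f})"
      using eS by blast
    have "e \<notin> cl (I i \<inter> S - {f})"
      using ne cl_mono[of "I i \<inter> S - {f}" "I i - {f}"] by blast
    then have "cl (insert e (I i \<inter> S - {f})) = cl (I i \<inter> S)"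
      using f fS circuit[OF RI e i] by (intro cl_swap_eq) auto
    then have "cl (I' j \<inter> S) = cl (I j \<inter> S)" for j
      unfolding I' fun_upd_apply using eq by (cases "j = i") simp_all
    then show ?case
      using step.IH by simp
  qed
  show ?thesis
  proof
    show "indep_packing k E I0"
      by (rule I0)
    show "S \<subseteq> E"
      unfolding S_def by blast
    show "E - (\<Union>i<k. I0 i) \<subseteq> S"
      unfolding S_def R_def by blast
    show "S \<subseteq> cl (I0 i \<inter> S)" if "i < k" for i
    proof
      fix e assume "e \<in> S"
      then obtain I where "R I" "e \<in> E - (\<Union>j<k. I j)"
        unfolding S_def by blast
      then show "e \<in> cl (I0 i \<inter> S)"
        using circuit[of I e i] invariant[of I] that by simp
    qed
  qed
qed

end


section \<open>Reachability and components\<close>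

definition reach :: "'v set set \<Rightarrow> ('v \<times> 'v) set" where
  "reach F = {(x, y). {x, y} \<in> F}\<^sup>*"

lemma reach_refl [simp]: "(x, x) \<in> reach F"
  by (simp add: reach_def)

lemma reach_edge: "{x, y} \<in> F \<Longrightarrow> (x, y) \<in> reach F"
  by (auto simp: reach_def)

lemma reach_trans: "(x, y) \<in> reach F \<Longrightarrow> (y, z) \<in> reach F \<Longrightarrow> (x, z) \<in> reach F"
  unfolding reach_def by (rule rtrancl_trans)

lemma reach_sym: "(x, y) \<in> reach F \<Longrightarrow> (y, x) \<in> reach F"
proof -
  have "sym ({(x, y). {x, y} \<in> F}\<^sup>*)"
    by (rule sym_rtrancl) (auto simp: sym_def insert_commute)
  then show "(x, y) \<in> reach F \<Longrightarrow> (y, x) \<in> reach F"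
    unfolding reach_def by (rule symD)
qed

lemma reach_least:
  assumes "(x, y) \<in> reach F" and "\<And>a b. {a, b} \<in> F \<Longrightarrow> (a, b) \<in> reach F'"
  shows "(x, y) \<in> reach F'"
proof -
  have "{(x, y). {x, y} \<in> F} \<subseteq> {(x, y). {x, y} \<in> F'}\<^sup>*"
    using assms(2) unfolding reach_def by auto
  then show ?thesis
    using assms(1) rtrancl_subset_rtrancl unfolding reach_def by blast
qed

lemma reach_mono: "(x, y) \<in> reach F \<Longrightarrow> F \<subseteq> F' \<Longrightarrow> (x, y) \<in> reach F'"
  by (erule reach_least) (auto intro: reach_edge)

lemma reach_insertD:
  assumes "(x, y) \<in> reach (insert {a, b} F)"
  shows "(x, y) \<in> reach F \<or> (x, a) \<in> reach F \<and> (b, y) \<in> reach F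
    \<or> (x, b) \<in> reach F \<and> (a, y) \<in> reach F"
  using assms unfolding reach_def[of "insert _ _"]
proof (induction rule: rtrancl_induct)
  case base
  then show ?case by simp
next
  case (step y z)
  from step.hyps(2) have "{y, z} \<in> F \<or> y = a \<and> z = b \<or> y = b \<and> z = a"
    by (auto simp: doubleton_eq_iff)
  then consider "(y, z) \<in> reach F" | "y = a" "z = b" | "y = b" "z = a"
    using reach_edge[of y z F] by blast
  then show ?case
  proof cases
    case 1
    then show ?thesis
      using step.IH reach_trans[of _ y F z] by blast
  next
    case 2
    then show ?thesis
      using step.IH by auto
  next
    case 3
    then show ?thesis
      using step.IH by auto
  qed
qed

definition component :: "'v set \<Rightarrow> 'v set set \<Rightarrow> 'v \<Rightarrow> 'v set" where
  "component V F x = {y \<in> V. (x, y) \<in> reach F}"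

definition components :: "'v set \<Rightarrow> 'v set set \<Rightarrow> 'v set set" where
  "components V F = component V F ` V"

lemma component_self: "x \<in> V \<Longrightarrow> x \<in> component V F x"
  by (simp add: component_def)

lemma component_eq_iff:
  assumes "x \<in> V" and "y \<in> V"
  shows "component V F x = component V F y \<longleftrightarrow> (x, y) \<in> reach F"
  using assms unfolding component_def by (auto dest: reach_sym intro: reach_trans)

lemma finite_components: "finite V \<Longrightarrow> finite (components V F)"
  by (simp add: components_def)

lemma partition_on_components: "partition_on V (components V F)"
proof (rule partition_onI)
  show "\<Union> (components V F) = V"
    using component_self unfolding components_def by (fastforce simp: component_def)
  show "{} \<notin> components V F"
    using component_self unfolding components_def by fastforce
  show "disjnt p q" if "p \<in> components V F" "q \<in> components V F" "p \<noteq> q" for p q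
  proof -
    obtain x y where xy: "p = component V F x" "x \<in> V" "q = component V F y" "y \<in> V"
      using \<open>p \<in> _\<close> \<open>q \<in> _\<close> unfolding components_def by blast
    have "(x, y) \<in> reach F" if "(x, z) \<in> reach F" "(y, z) \<in> reach F" for z
      using that(1) reach_sym[OF that(2)] by (rule reach_trans)
    moreover have "(x, y) \<notin> reach F"
      using xy \<open>p \<noteq> q\<close> component_eq_iff by metis
    ultimately show ?thesis
      unfolding xy disjnt_iff component_def by blast
  qed
qed

lemma card_components_empty: "card (components V {}) = card V"
proof -
  have "(x, y) \<in> reach {} \<longleftrightarrow> x = y" for x y :: 'a
    by (simp add: reach_def)
  then have "inj_on (component V {}) V"
    by (auto simp: inj_on_def component_eq_iff)
  then show ?thesis
    unfolding components_def by (rule card_image)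
qed

lemma components_insert_absorb:
  assumes "(a, b) \<in> reach F"
  shows "components V (insert {a, b} F) = components V F"
proof -
  have "(x, y) \<in> reach (insert {a, b} F) \<longleftrightarrow> (x, y) \<in> reach F" for x y
    using assms by (meson reach_insertD reach_mono reach_sym reach_trans subset_insertI)
  then show ?thesis
    by (simp add: components_def component_def)
qed

lemma card_components_insert:
  assumes fin: "finite V" and V: "a \<in> V" "b \<in> V" and ab: "(a, b) \<notin> reach F"
  shows "card (components V (insert {a, b} F)) + 1 = card (components V F)"
proof -
  let ?A = "component V F a" and ?B = "component V F b" and ?F = "insert {a, b} F"
  have ne: "?A \<noteq> ?B"
    using V ab by (simp add: component_eq_iff)
  have up: "(x, y) \<in> reach ?F" if "(x, y) \<in> reach F" for x y
    using that by (rule reach_mono) blast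
  have bridge: "(a, b) \<in> reach ?F"
    by (rule reach_edge) simp
  have reach: "(x, y) \<in> reach ?F \<longleftrightarrow> (x, y) \<in> reach F \<or> (x, a) \<in> reach F \<and> (b, y) \<in> reach F
      \<or> (x, b) \<in> reach F \<and> (a, y) \<in> reach F" for x y
    using reach_insertD[of x y a b F] up bridge by (meson reach_sym reach_trans)
  have merged: "component V ?F x = ?A \<union> ?B" if "x \<in> V" "component V F x \<in> {?A, ?B}" for x
  proof -
    have "(x, a) \<in> reach F \<or> (x, b) \<in> reach F"
      using that V by (auto simp: component_eq_iff)
    then show ?thesis
      unfolding component_def reach by (auto dest: reach_sym intro: reach_trans)
  qed
  have kept: "component V ?F x = component V F x" if "x \<in> V" "component V F x \<notin> {?A, ?B}" for x
  proof -
    have "(x, a) \<notin> reach F \<and> (x, b) \<notin> reach F"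
      using that V by (auto simp: component_eq_iff)
    then show ?thesis
      unfolding component_def reach by auto
  qed
  have "components V ?F = insert (?A \<union> ?B) (components V F - {?A, ?B})"
  proof
    show "components V ?F \<subseteq> insert (?A \<union> ?B) (components V F - {?A, ?B})"
    proof
      fix C assume "C \<in> components V ?F"
      then obtain x where x: "x \<in> V" "C = component V ?F x"
        unfolding components_def by blast
      show "C \<in> insert (?A \<union> ?B) (components V F - {?A, ?B})"
      proof (cases "component V F x \<in> {?A, ?B}")
        case True
        then show ?thesis
          using merged[OF x(1)] x(2) by simp
      next
        case False
        then show ?thesis
          using kept[OF x(1)] x unfolding components_def by simp
      qed
    qed
    have "?A \<union> ?B \<in> components V ?F"
      using merged[of a] V unfolding components_def by auto
    moreover have "components V F - {?A, ?B} \<subseteq> components V ?F"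
    proof
      fix C assume C: "C \<in> components V F - {?A, ?B}"
      then obtain x where x: "x \<in> V" "C = component V F x"
        unfolding components_def by blast
      then have "C = component V ?F x"
        using kept[OF x(1)] C by simp
      then show "C \<in> components V ?F"
        using x(1) unfolding components_def by blast
    qed
    ultimately show "insert (?A \<union> ?B) (components V F - {?A, ?B}) \<subseteq> components V ?F"
      by blast
  qed
  moreover have "?A \<union> ?B \<notin> components V F - {?A, ?B}"
  proof
    assume "?A \<union> ?B \<in> components V F - {?A, ?B}"
    then obtain x where x: "x \<in> V" "component V F x = ?A \<union> ?B"
      unfolding components_def by auto
    then have "(x, a) \<in> reach F" "(x, b) \<in> reach F"
      using component_self[OF V(1)] component_self[OF V(2)] unfolding component_def by blast+
    then show False
      using ab reach_sym[of x a F] reach_trans[of a x F b] by blast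
  qed
  moreover have "card (components V F - {?A, ?B}) + 2 = card (components V F)"
  proof -
    have "{?A, ?B} \<subseteq> components V F"
      using V by (auto simp: components_def)
    then show ?thesis
      using ne fin card_mono[of "components V F" "{?A, ?B}"]
      by (simp add: card_Diff_subset finite_components)
  qed
  ultimately show ?thesis
    using fin by (simp add: finite_components)
qed

lemma simple_graph_edgeE:
  assumes "simple_graph V F" and "f \<in> F"
  obtains x y where "f = {x, y}" and "x \<noteq> y" and "x \<in> V" and "y \<in> V"
  using assms unfolding simple_graph_def by (metis card_2_iff insert_subset)

lemma simple_graph_subset: "simple_graph V F \<Longrightarrow> F' \<subseteq> F \<Longrightarrow> simple_graph V F'"
  by (auto simp: simple_graph_def)

lemma finite_simple_graph: "finite V \<Longrightarrow> simple_graph V F \<Longrightarrow> finite F"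
  unfolding simple_graph_def by (meson PowI finite_Pow_iff finite_subset subsetI)

text \<open>An edge merges at most two components, whether or not it closes a cycle.\<close>

lemma card_components_Un:
  assumes V: "finite V" and "finite F" and "simple_graph V F"
  shows "card (components V N) \<le> card (components V (N \<union> F)) + card F"
  using assms(2,3)
proof (induction rule: finite_induct)
  case empty
  then show ?case by simp
next
  case (insert f F)
  then have IH: "card (components V N) \<le> card (components V (N \<union> F)) + card F"
    by (simp add: simple_graph_def)
  obtain a b where f: "f = {a, b}" and ab: "a \<in> V" "b \<in> V"
    using insert.prems by (auto elim: simple_graph_edgeE)
  have "card (components V (N \<union> F)) \<le> card (components V (insert f (N \<union> F))) + 1"
    using components_insert_absorb[of a b "N \<union> F" V] card_components_insert[OF V ab, of "N \<union> F"]
    unfolding f by (cases "(a, b) \<in> reach (N \<union> F)") auto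
  then show ?case
    using IH insert.hyps by simp
qed

lemma connected_iff_card_components:
  assumes "finite V"
  shows "connected_graph V F \<longleftrightarrow> card (components V F) = 1"
proof
  assume F: "connected_graph V F"
  then obtain x where x: "x \<in> V"
    unfolding connected_graph_def by auto
  have "component V F y = component V F x" if "y \<in> V" for y
    using F that x unfolding connected_graph_def reach_def[symmetric]
    by (simp add: component_eq_iff)
  then have "components V F \<subseteq> {component V F x}"
    unfolding components_def by blast
  then have "components V F = {component V F x}"
    using x unfolding components_def by blast
  then show "card (components V F) = 1"
    by simp
next
  assume "card (components V F) = 1"
  then obtain C where C: "components V F = {C}"
    by (rule card_1_singletonE)
  then have "component V F x = C" if "x \<in> V" for x
    using that unfolding components_def by auto
  then have "(x, y) \<in> reach F" if "x \<in> V" "y \<in> V" for x y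
    using that component_eq_iff[of x V y F] by simp
  moreover have "V \<noteq> {}"
    using C unfolding components_def by auto
  ultimately show "connected_graph V F"
    unfolding connected_graph_def reach_def[symmetric] by blast
qed

lemma card_edges_ge_if_connected:
  assumes "finite V" and "simple_graph V F" and "connected_graph V F"
  shows "card V - 1 \<le> card F"
  using card_components_Un[of V F "{}"] assms finite_simple_graph[OF assms(1,2)]
  by (simp add: card_components_empty connected_iff_card_components)

text \<open>
  The edges inside blocks alone leave at least as many components as there are blocks meeting \<open>W\<close>,
  and every crossing edge can merge only two of them.
\<close>

lemma card_crossing_edges_ge:
  assumes W: "finite W" and P: "disjoint P"
    and F: "simple_graph W F" "connected_graph W F"
  shows "card {B \<in> P. B \<inter> W \<noteq> {}} - 1 \<le> card {f \<in> F. \<not> (\<exists>B\<in>P. f \<subseteq> B)}"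
proof -
  let ?N = "{f \<in> F. \<exists>B\<in>P. f \<subseteq> B}" and ?X = "{f \<in> F. \<not> (\<exists>B\<in>P. f \<subseteq> B)}"
  have stay: "y \<in> B" if "(x, y) \<in> reach ?N" "x \<in> B" "B \<in> P" for x y B
    using that(1) unfolding reach_def
  proof (induction rule: rtrancl_induct)
    case base
    then show ?case using that by simp
  next
    case (step y z)
    then obtain B' where "B' \<in> P" "{y, z} \<subseteq> B'"
      by auto
    then show ?case
      using step.IH that(3) P unfolding disjoint_def by blast
  qed
  \<comment> \<open>Every component of the inner edges lies in one block, so components map onto the blocks met.\<close>
  define b where "b C = (SOME B. B \<in> P \<and> C \<subseteq> B)" for C
  have "{B \<in> P. B \<inter> W \<noteq> {}} \<subseteq> b ` components W ?N"
  proof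
    fix B assume "B \<in> {B \<in> P. B \<inter> W \<noteq> {}}"
    then obtain x where B: "B \<in> P" and x: "x \<in> B" "x \<in> W"
      by blast
    let ?C = "component W ?N x"
    have "?C \<subseteq> B"
      using stay x B unfolding component_def by blast
    then have "\<exists>B. B \<in> P \<and> ?C \<subseteq> B"
      using B by blast
    then have b: "b ?C \<in> P \<and> ?C \<subseteq> b ?C"
      unfolding b_def by (rule someI_ex)
    then have "x \<in> b ?C \<inter> B"
      using component_self[OF x(2)] x(1) by blast
    then have "b ?C = B"
      using b B P unfolding disjoint_def by blast
    then show "B \<in> b ` components W ?N"
      using x unfolding components_def by blast
  qed
  then have "card {B \<in> P. B \<inter> W \<noteq> {}} \<le> card (components W ?N)"
    using surj_card_le[OF finite_components[OF W]] by blast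
  also have "\<dots> \<le> card (components W (?N \<union> ?X)) + card ?X"
    using W finite_simple_graph[OF W F(1)] simple_graph_subset[OF F(1), of ?X]
    by (intro card_components_Un) auto
  also have "?N \<union> ?X = F"
    by blast
  also have "card (components W F) = 1"
    using W F by (simp add: connected_iff_card_components)
  finally show ?thesis
    by simp
qed


section \<open>Cycles\<close>

lemma reach_distinct_path:
  assumes "(x, y) \<in> reach F"
  obtains p where "p \<noteq> []" and "hd p = x" and "last p = y" and "distinct p"
    and "\<And>i. Suc i < length p \<Longrightarrow> {p ! i, p ! Suc i} \<in> F"
proof -
  have "\<exists>p. p \<noteq> [] \<and> hd p = x \<and> last p = y \<and> distinct p \<and>
      (\<forall>i. Suc i < length p \<longrightarrow> {p ! i, p ! Suc i} \<in> F)"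
    using assms unfolding reach_def
  proof (induction rule: rtrancl_induct)
    case base
    show ?case
      by (rule exI[of _ "[x]"]) simp
  next
    case (step y z)
    then obtain p where p: "p \<noteq> []" "hd p = x" "last p = y" "distinct p"
      "\<And>i. Suc i < length p \<Longrightarrow> {p ! i, p ! Suc i} \<in> F" and yz: "{y, z} \<in> F"
      by auto
    show ?case
    proof (cases "z \<in> set p")
      case True
      then obtain j where j: "j < length p" "p ! j = z"
        by (metis in_set_conv_nth)
      let ?q = "take (Suc j) p"
      have "last ?q = z"
        using j by (simp add: take_Suc_conv_app_nth)
      then show ?thesis
        using p j by (intro exI[of _ ?q]) auto
    next
      case False
      have "{(p @ [z]) ! i, (p @ [z]) ! Suc i} \<in> F" if "Suc i < length (p @ [z])" for i
      proof (cases "Suc i < length p")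
        case True
        then show ?thesis
          using p(5) by (simp add: nth_append)
      next
        case False
        then have len: "length p = Suc i"
          using that by simp
        then have "p ! i = y"
          using p(1,3) by (simp add: last_conv_nth)
        then show ?thesis
          using yz len by (simp add: nth_append)
      qed
      then show ?thesis
        using p False by (intro exI[of _ "p @ [z]"]) auto
    qed
  qed
  then show ?thesis
    using that by blast
qed

text \<open>
  This lemma and its converse below translate between cycles as vertex lists and the edge-wise
  condition for being independent in the cycle matroid.
\<close>

lemma cycle_if_edge_bypassed:
  assumes "{x, y} \<in> F" and "x \<noteq> y" and "(x, y) \<in> reach (F - {{x, y}})"
  shows "\<exists>c. graph_cycle F c"
proof -
  obtain p where p: "p \<noteq> []" "hd p = x" "last p = y" "distinct p"
    "\<And>i. Suc i < length p \<Longrightarrow> {p ! i, p ! Suc i} \<in> F - {{x, y}}"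
    by (rule reach_distinct_path[OF assms(3)]) blast
  have x: "p ! 0 = x" and y: "p ! (length p - 1) = y"
    using p by (simp_all add: hd_conv_nth last_conv_nth)
  \<comment> \<open>A path with two vertices would be the bypassed edge itself.\<close>
  have "length p \<noteq> 1"
    using x y assms(2) by auto
  moreover have "length p \<noteq> 2"
    using x y p(5)[of 0] by (auto simp: numeral_2_eq_2)
  moreover have "length p \<noteq> 0"
    using p(1) by simp
  ultimately have "3 \<le> length p"
    by linarith
  moreover have "{p ! i, p ! (Suc i mod length p)} \<in> F" if "i < length p" for i
  proof (cases "Suc i = length p")
    case True
    then have "i = length p - 1"
      by simp
    then show ?thesis
      using x y True assms(1) by (simp add: insert_commute)
  next
    case False
    then show ?thesis
      using that p(5)[of i] by simp
  qed
  ultimately show ?thesis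
    using p(4) unfolding graph_cycle_def by blast
qed

lemma edge_bypassed_if_cycle:
  assumes "graph_cycle F c"
  obtains x y where "{x, y} \<in> F" and "(x, y) \<in> reach (F - {{x, y}})"
proof -
  let ?n = "length c"
  let ?x = "c ! 0" and ?y = "c ! (?n - 1)"
  have n: "3 \<le> ?n" and d: "distinct c"
    and edge: "\<And>i. i < ?n \<Longrightarrow> {c ! i, c ! (Suc i mod ?n)} \<in> F"
    using assms by (auto simp: graph_cycle_def)
  have "Suc (?n - 1) = ?n"
    using n by linarith
  then have "{?x, ?y} \<in> F"
    using edge[of "?n - 1"] n by (simp add: insert_commute)
  moreover have "(?x, c ! i) \<in> reach (F - {{?x, ?y}})" if "i < ?n" for i
    using that
  proof (induction i)
    case 0
    then show ?case by simp
  next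
    case (Suc i)
    have "{c ! i, c ! Suc i} \<in> F"
      using edge[of i] Suc.prems by simp
    moreover have "{c ! i, c ! Suc i} \<noteq> {?x, ?y}"
    proof
      assume "{c ! i, c ! Suc i} = {?x, ?y}"
      then have "c ! i = ?x \<and> c ! Suc i = ?y \<or> c ! i = ?y \<and> c ! Suc i = ?x"
        by (simp add: doubleton_eq_iff)
      moreover have "0 < ?n" "?n - 1 < ?n" "i < ?n"
        using n Suc.prems by auto
      ultimately have "i = 0 \<and> Suc i = ?n - 1 \<or> i = ?n - 1 \<and> Suc i = 0"
        using Suc.prems nth_eq_iff_index_eq[OF d] by blast
      then show False
        using n by auto
    qed
    ultimately have "(c ! i, c ! Suc i) \<in> reach (F - {{?x, ?y}})"
      by (intro reach_edge) blast
    then show ?case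
      using Suc by (meson Suc_lessD reach_trans)
  qed
  then have "(?x, ?y) \<in> reach (F - {{?x, ?y}})"
    using n by simp
  ultimately show ?thesis
    by (rule that)
qed


section \<open>The cycle matroid of labelled edges\<close>

text \<open>
  The union with \<open>A\<close> matters only for occurrences whose second component is not a pair of
  endpoints; it makes the closure laws hold for arbitrary labelled sets.
\<close>

definition span_edges :: "('e \<times> 'v set) set \<Rightarrow> ('e \<times> 'v set) set" where
  "span_edges A = A \<union> {e. \<exists>x y. snd e = {x, y} \<and> (x, y) \<in> reach (snd ` A)}"

lemma span_edgesI: "snd e = {x, y} \<Longrightarrow> (x, y) \<in> reach (snd ` A) \<Longrightarrow> e \<in> span_edges A"
  by (auto simp: span_edges_def)

lemma span_edgesD:
  assumes "e \<in> span_edges A" and "snd e = {x, y}"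
  shows "(x, y) \<in> reach (snd ` A)"
proof (cases "e \<in> A")
  case True
  then show ?thesis
    using assms(2) by (metis image_eqI reach_edge)
next
  case False
  then show ?thesis
    using assms reach_sym by (auto simp: span_edges_def doubleton_eq_iff)
qed

lemma reach_if_subset_span:
  assumes "A \<subseteq> span_edges B" and "(x, y) \<in> reach (snd ` A)"
  shows "(x, y) \<in> reach (snd ` B)"
  using assms(2)
proof (rule reach_least)
  fix a b assume "{a, b} \<in> snd ` A"
  then obtain e where "e \<in> A" "snd e = {a, b}"
    by (metis imageE)
  then show "(a, b) \<in> reach (snd ` B)"
    using assms(1) span_edgesD[of e B a b] by blast
qed

interpretation span: exchange_closure "span_edges :: ('e \<times> 'v set) set \<Rightarrow> _"
proof
  fix A B :: "('e \<times> 'v set) set" and e f :: "'e \<times> 'v set"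
  show "A \<subseteq> span_edges A"
    by (auto simp: span_edges_def)
  show "span_edges A \<subseteq> span_edges B" if "A \<subseteq> span_edges B"
  proof
    fix e assume "e \<in> span_edges A"
    then consider "e \<in> A" | x y where "snd e = {x, y}" "(x, y) \<in> reach (snd ` A)"
      unfolding span_edges_def by blast
    then show "e \<in> span_edges B"
    proof cases
      case 1
      then show ?thesis
        using that by blast
    next
      case 2
      from 2(1) reach_if_subset_span[OF that 2(2)] show ?thesis
        by (rule span_edgesI)
    qed
  qed
  assume e: "e \<in> span_edges (insert f A)" and ne: "e \<notin> span_edges A"
  show "f \<in> span_edges (insert e A)"
  proof (cases "e = f")
    case True
    then show ?thesis
      by (simp add: span_edges_def)
  next
    case False
    then obtain x y where xy: "snd e = {x, y}" "(x, y) \<in> reach (insert (snd f) (snd ` A))"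
      using e ne by (auto simp: span_edges_def)
    have new: "(x, y) \<notin> reach (snd ` A)"
      using ne span_edgesI[OF xy(1), of A] by blast
    have "\<exists>a b. snd f = {a, b}"
    proof (rule ccontr)
      assume no: "\<nexists>a b. snd f = {a, b}"
      have "(x, y) \<in> reach (snd ` A)"
        using xy(2)
      proof (rule reach_least)
        fix a b assume "{a, b} \<in> insert (snd f) (snd ` A)"
        then have "{a, b} \<in> snd ` A"
          using no by (metis insertE)
        then show "(a, b) \<in> reach (snd ` A)"
          by (rule reach_edge)
      qed
      then show False
        using new by simp
    qed
    then obtain a b where ab: "snd f = {a, b}"
      by blast
    have "(x, a) \<in> reach (snd ` A) \<and> (b, y) \<in> reach (snd ` A)
        \<or> (x, b) \<in> reach (snd ` A) \<and> (a, y) \<in> reach (snd ` A)"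
      using reach_insertD[of x y a b "snd ` A"] xy(2) new unfolding ab by blast
    moreover have "(x, y) \<in> reach (snd ` insert e A)"
      using xy(1) by (intro reach_edge) simp
    moreover have "(u, v) \<in> reach (snd ` insert e A)" if "(u, v) \<in> reach (snd ` A)" for u v
      using that by (rule reach_mono) auto
    ultimately have "(a, b) \<in> reach (snd ` insert e A)"
      by (meson reach_sym reach_trans)
    then show ?thesis
      by (rule span_edgesI[OF ab])
  qed
qed

text \<open>
  Each edge of a forest joins two components of the edges before it, so \<open>card_components_insert\<close>
  applies at every step.
\<close>

lemma card_components_if_indep:
  assumes V: "finite V" and "finite A" and "simple_graph V (snd ` A)" and "span.indep A"
  shows "card A + card (components V (snd ` A)) = card V"
  using assms(2-)
proof (induction rule: finite_induct)
  case empty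
  then show ?case by (simp add: card_components_empty)
next
  case (insert e A)
  have IH: "card A + card (components V (snd ` A)) = card V"
    using insert.prems by (intro insert.IH)
      (auto simp: simple_graph_def intro: span.indep_subset)
  obtain a b where e: "snd e = {a, b}" and ab: "a \<in> V" "b \<in> V"
    using insert.prems(1) by (auto elim: simple_graph_edgeE)
  have "e \<notin> span_edges A"
    using insert.prems(2) insert.hyps(2) by (auto simp: span.indep_def)
  then have "(a, b) \<notin> reach (snd ` A)"
    using span_edgesI[OF e] by blast
  from card_components_insert[OF V ab this] show ?case
    using IH insert.hyps e by simp
qed

lemma inj_on_snd_if_indep:
  assumes "span.indep A" and "simple_graph V (snd ` A)"
  shows "inj_on snd A"
proof (rule inj_onI, rule ccontr)
  fix e f assume ef: "e \<in> A" "f \<in> A" "snd e = snd f" "e \<noteq> f"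
  obtain x y where xy: "snd e = {x, y}"
    using assms(2) ef(1) by (meson imageI simple_graph_edgeE)
  have "f \<in> A - {e}"
    using ef by blast
  then have "{x, y} \<in> snd ` (A - {e})"
    using ef(3) xy by (metis imageI)
  then have "e \<in> span_edges (A - {e})"
    by (intro span_edgesI[OF xy] reach_edge)
  then show False
    using assms(1) ef(1) by (simp add: span.indep_def)
qed

lemma acyclic_if_indep:
  assumes "span.indep A" and "inj_on snd A"
  shows "\<nexists>c. graph_cycle (snd ` A) c"
proof
  assume "\<exists>c. graph_cycle (snd ` A) c"
  then obtain c where "graph_cycle (snd ` A) c"
    by blast
  then obtain x y where xy: "{x, y} \<in> snd ` A" "(x, y) \<in> reach (snd ` A - {{x, y}})"
    by (rule edge_bypassed_if_cycle)
  then obtain e where e: "e \<in> A" "snd e = {x, y}"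
    by (metis imageE)
  have "snd ` (A - {e}) = snd ` A - {{x, y}}"
    using assms(2) e by (auto simp: inj_on_def)
  then have "e \<in> span_edges (A - {e})"
    using xy(2) by (intro span_edgesI[OF e(2)]) simp
  then show False
    using assms(1) e(1) by (simp add: span.indep_def)
qed

lemma spanning_tree_if_indep:
  assumes V: "finite V" and A: "finite A" "A \<subseteq> G" and G: "simple_graph V (snd ` G)"
    and ind: "span.indep A" and card: "card A + 1 = card V"
  shows "spanning_tree V G A"
proof -
  have sg: "simple_graph V (snd ` A)"
    using G A(2) by (meson image_mono simple_graph_subset)
  have inj: "inj_on snd A"
    using ind sg by (rule inj_on_snd_if_indep)
  have "card (components V (snd ` A)) = 1"
    using card_components_if_indep[OF V A(1) sg ind] card by simp
  then show ?thesis
    using A(2) sg inj acyclic_if_indep[OF ind inj] V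
    by (simp add: spanning_tree_def simple_tree_def connected_iff_card_components)
qed

text \<open>
  Giving all edges the same label makes a simple graph a set of edge occurrences, and the absence of
  cycles makes this set independent, so that its size is determined by the number of components.
\<close>

lemma card_edges_simple_tree:
  assumes V: "finite V" and F: "simple_tree V F"
  shows "card F + 1 = card V"
proof -
  let ?A = "Pair () ` F"
  have snd: "snd ` ?A = F"
    by (simp add: image_image)
  have sg: "simple_graph V F" and con: "connected_graph V F" and ac: "\<nexists>c. graph_cycle F c"
    using F by (auto simp: simple_tree_def)
  have "span.indep ?A"
    unfolding span.indep_def
  proof (intro ballI notI)
    fix e assume e: "e \<in> ?A" and dep: "e \<in> span_edges (?A - {e})"
    then have eF: "snd e \<in> F"
      by auto
    obtain x y where xy: "snd e = {x, y}" "x \<noteq> y"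
      using simple_graph_edgeE[OF sg eF] by blast
    have "(x, y) \<in> reach (snd ` (?A - {e}))"
      using dep xy(1) by (rule span_edgesD)
    moreover have "e = ((), {x, y})"
      using xy(1) by (simp add: prod_eq_iff)
    then have "?A - {e} = Pair () ` (F - {{x, y}})"
      by blast
    then have "snd ` (?A - {e}) = F - {{x, y}}"
      by (simp add: image_image)
    ultimately show False
      using cycle_if_edge_bypassed[of x y F] xy eF ac by simp
  qed
  then have "card ?A + card (components V F) = card V"
    using card_components_if_indep[of V ?A] V sg finite_simple_graph[OF V sg] snd by simp
  then show ?thesis
    using con V by (simp add: connected_iff_card_components card_image inj_on_def)
qed


section \<open>Packing spanning trees\<close>

text \<open>
  Let \<open>S\<close> be the tight set of a packing by forests and let \<open>P\<close> be the partition of \<open>V\<close> into the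
  components of \<open>S\<close>. Each forest meets \<open>S\<close> in exactly \<open>|V| - |P|\<close> edges. The edges that cross
  \<open>P\<close> lie outside \<open>S\<close> and are therefore covered, so at least \<open>k(|P| - 1)\<close> crossing edges force
  the forests to have total size \<open>k(|V| - 1)\<close>, which is the most that \<open>k\<close> forests can have.
\<close>

theorem tree_packing:
  fixes G :: "('e \<times> 'v set) set"
  assumes V: "finite V" "V \<noteq> {}" and finG: "finite G" and G: "simple_graph V (snd ` G)"
    and cross: "\<And>P. partition_on V P \<Longrightarrow>
      k * (card P - 1) \<le> card {e \<in> G. \<not> (\<exists>B\<in>P. snd e \<subseteq> B)}"
  obtains I where "\<And>i. i < k \<Longrightarrow> spanning_tree V G (I i)" and "disjoint_family_on I {..<k}"
    and "\<And>i. i < k \<Longrightarrow> card (I i) + 1 = card V"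
proof -
  obtain I S where I: "span.indep_packing k G I" and S: "S \<subseteq> G" "G - (\<Union>i<k. I i) \<subseteq> S"
    and tight: "\<And>i. i < k \<Longrightarrow> S \<subseteq> span_edges (I i \<inter> S)"
    using span.exists_packing_with_tight_set[OF finG, of k] by metis
  have sub: "I i \<subseteq> G" and ind: "span.indep (I i)" and fin: "finite (I i)" if "i < k" for i
    using I that finG unfolding span.indep_packing_def by (auto intro: finite_subset)
  have disj: "disjoint_family_on I {..<k}"
    using I unfolding span.indep_packing_def by simp
  have sg: "simple_graph V (snd ` A)" if "A \<subseteq> G" for A
    using G that by (meson image_mono simple_graph_subset)
  define P where "P = components V (snd ` S)"
  have P: "partition_on V P"
    unfolding P_def by (rule partition_on_components)
  have P_pos: "1 \<le> card P" if "P = components V A" for P A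
    using that V finite_components[OF V(1)] by (simp add: components_def Suc_le_eq card_gt_0_iff)
  have inside: "card (I i \<inter> S) + card P = card V" if i: "i < k" for i
  proof -
    have "(x, y) \<in> reach (snd ` S) \<longleftrightarrow> (x, y) \<in> reach (snd ` (I i \<inter> S))" for x y
      using reach_if_subset_span[OF tight[OF i]] reach_mono[of x y "snd ` (I i \<inter> S)" "snd ` S"]
      by auto
    then have "P = components V (snd ` (I i \<inter> S))"
      by (simp add: P_def components_def component_def)
    moreover have "span.indep (I i \<inter> S)" and "finite (I i \<inter> S)"
      using ind[OF i] fin[OF i] by (auto intro: span.indep_subset)
    moreover have "simple_graph V (snd ` (I i \<inter> S))"
      using S(1) by (intro sg) auto
    ultimately show ?thesis
      using card_components_if_indep[OF V(1)] by metis
  qed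
  have le: "card (I i) \<le> card V - 1" if i: "i < k" for i
    using card_components_if_indep[OF V(1) fin[OF i] sg[OF sub[OF i]] ind[OF i]]
      P_pos[OF refl, of "snd ` I i"] by linarith
  have "{e \<in> G. \<not> (\<exists>B\<in>P. snd e \<subseteq> B)} \<subseteq> G - S"
  proof safe
    fix a f assume e: "(a, f) \<in> S" and no: "\<not> (\<exists>B\<in>P. snd (a, f) \<subseteq> B)"
    obtain x y where xy: "f = {x, y}" "x \<in> V" "y \<in> V"
      using sg[OF S(1)] e by (metis image_eqI simple_graph_edgeE snd_conv)
    have "(x, y) \<in> reach (snd ` S)"
      using e xy(1) by (intro reach_edge) force
    then have "f \<subseteq> component V (snd ` S) x"
      using xy by (simp add: component_def)
    then show False
      using no xy(2) unfolding P_def components_def by auto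
  qed
  then have "k * (card P - 1) \<le> card (G - S)"
    using cross[OF P] finG by (meson card_mono finite_Diff order_trans)
  also have "\<dots> \<le> card (\<Union>i<k. I i - S)"
    using S fin by (intro card_mono) auto
  also have "\<dots> \<le> (\<Sum>i<k. card (I i - S))"
    by (intro card_UN_le) simp
  finally have outside: "k * (card P - 1) \<le> (\<Sum>i<k. card (I i - S))" .
  have split: "card (I i) = card (I i - S) + card (I i \<inter> S)" if "i < k" for i
    using card_Int_Diff[OF fin[OF that], of S] by simp
  have full: "card (I i) = card V - 1" if i: "i < k" for i
  proof (rule ccontr)
    assume "card (I i) \<noteq> card V - 1"
    then have small: "card (I i - S) < card P - 1"
      using le[OF i] inside[OF i] split[OF i] P_pos[OF P_def] by linarith
    have "card (I j - S) \<le> card P - 1" if "j < k" for j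
      using le[OF that] inside[OF that] split[OF that] by linarith
    then have "(\<Sum>j<k. card (I j - S)) < (\<Sum>j<k. card P - 1)"
      using i small by (intro sum_strict_mono_ex1) auto
    then show False
      using outside by simp
  qed
  have "card (I i) + 1 = card V" if "i < k" for i
    using full[OF that] V by (simp add: Suc_le_eq card_gt_0_iff)
  moreover from this have "spanning_tree V G (I i)" if "i < k" for i
    using that V(1) fin sub G ind by (intro spanning_tree_if_indep) auto
  ultimately show ?thesis
    using that disj by blast
qed


section \<open>Tree assignments\<close>

context labelled_multihypergraph
begin

lemma finite_support: "e \<in> hedges H \<Longrightarrow> finite (support H e)"
  using finite_verts support_subset finite_subset by blast

lemma simple_graph_assigned:
  assumes "tree_assignment H F"
  shows "simple_graph (verts H) (snd ` assigned_graph H F)"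
  using assms support_subset
  unfolding tree_assignment_def assigned_graph_def simple_tree_def simple_graph_def by fastforce

lemma finite_tree:
  assumes "tree_assignment H F" and "e \<in> hedges H"
  shows "finite (F e)"
  using assms finite_support finite_simple_graph
  unfolding tree_assignment_def simple_tree_def by blast

lemma finite_assigned: "tree_assignment H F \<Longrightarrow> finite (assigned_graph H F)"
  unfolding assigned_graph_def using finite_hedges finite_tree by blast

lemma card_assigned:
  assumes "tree_assignment H F"
  shows "card (assigned_graph H F) = rho H"
proof -
  have "card (F e) = card (support H e) - 1" if "e \<in> hedges H" for e
    using assms that card_edges_simple_tree[OF finite_support[OF that]]
    unfolding tree_assignment_def by (metis add_diff_cancel_right')
  then show ?thesis
    unfolding assigned_graph_def rho_def
    using finite_hedges finite_tree[OF assms] by simp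
qed

text \<open>
  The crossing edges split by label, and each label contributes what its own tree must.
\<close>

lemma partition_weight_le_crossing:
  assumes F: "tree_assignment H F" and P: "partition_on (verts H) P"
  shows "partition_weight H P \<le> card {e \<in> assigned_graph H F. \<not> (\<exists>B\<in>P. snd e \<subseteq> B)}"
proof -
  have "{e \<in> assigned_graph H F. \<not> (\<exists>B\<in>P. snd e \<subseteq> B)} =
      (SIGMA e:hedges H. {f \<in> F e. \<not> (\<exists>B\<in>P. f \<subseteq> B)})"
    by (auto simp: assigned_graph_def)
  then have "card {e \<in> assigned_graph H F. \<not> (\<exists>B\<in>P. snd e \<subseteq> B)} =
      (\<Sum>e\<in>hedges H. card {f \<in> F e. \<not> (\<exists>B\<in>P. f \<subseteq> B)})"
    using finite_hedges finite_tree[OF F] by simp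
  moreover have "blocks_met H P e - 1 \<le> card {f \<in> F e. \<not> (\<exists>B\<in>P. f \<subseteq> B)}"
    if "e \<in> hedges H" for e
    using F that finite_support[OF that] partition_onD2[OF P]
    unfolding blocks_met_def tree_assignment_def simple_tree_def
    by (intro card_crossing_edges_ge) auto
  ultimately show ?thesis
    unfolding partition_weight_def by (simp add: sum_mono)
qed

lemma exists_spanning_tree_packing:
  assumes H: "weakly_partition_connected k H" and F: "tree_assignment H F"
  shows "\<exists>\<T>. spanning_tree_packing k (verts H) (assigned_graph H F) \<T>"
proof -
  have ne: "verts H \<noteq> {}"
    using two_le_card_verts by auto
  have cross: "k * (card P - 1) \<le> card {e \<in> assigned_graph H F. \<not> (\<exists>B\<in>P. snd e \<subseteq> B)}"
    if "partition_on (verts H) P" for P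
    using H that partition_weight_le_crossing[OF F that]
    unfolding weakly_partition_connected_def by (meson order_trans)
  obtain I where I: "\<And>i. i < k \<Longrightarrow> spanning_tree (verts H) (assigned_graph H F) (I i)"
    and disj: "disjoint_family_on I {..<k}"
    and card: "\<And>i. i < k \<Longrightarrow> card (I i) + 1 = card (verts H)"
    by (rule tree_packing[OF finite_verts ne finite_assigned[OF F] simple_graph_assigned[OF F] cross])
      auto
  \<comment> \<open>Disjoint sets are distinct as soon as they are nonempty; this is where two vertices count.\<close>
  have "I i \<noteq> {}" if "i < k" for i
    using card[OF that] two_le_card_verts by auto
  then have "inj_on I {..<k}"
    using disj unfolding inj_on_def disjoint_family_on_def by (metis Int_absorb lessThan_iff)
  then have "card (I ` {..<k}) = k"
    by (simp add: card_image)
  moreover have "disjoint (I ` {..<k})"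
    using disj by (rule disjoint_family_on_disjoint_image)
  ultimately show ?thesis
    using I unfolding spanning_tree_packing_def by (intro exI[of _ "I ` {..<k}"]) auto
qed

text \<open>
  Each of the \<open>k\<close> trees has at least \<open>|V| - 1\<close> edges, and criticality says that the whole
  assigned graph has no more than \<open>k(|V| - 1)\<close>.
\<close>

lemma critical_packing_exhausts:
  assumes crit: "critical k H" and F: "tree_assignment H F"
    and T: "spanning_tree_packing k (verts H) (assigned_graph H F) \<T>"
  shows "\<Union>\<T> = assigned_graph H F"
proof (rule card_seteq)
  let ?G = "assigned_graph H F"
  have st: "\<And>T. T \<in> \<T> \<Longrightarrow> spanning_tree (verts H) ?G T" and disj: "disjoint \<T>"
    and card: "card \<T> = k"
    using T by (auto simp: spanning_tree_packing_def)
  show fin: "finite ?G"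
    using F by (rule finite_assigned)
  show sub: "\<Union>\<T> \<subseteq> ?G"
    using st by (auto simp: spanning_tree_def)
  have "card (verts H) - 1 \<le> card T" if "T \<in> \<T>" for T
  proof -
    have "card (snd ` T) = card T"
      using st[OF that] by (simp add: spanning_tree_def card_image)
    then show ?thesis
      using st[OF that] card_edges_ge_if_connected[OF finite_verts]
      by (metis simple_tree_def spanning_tree_def)
  qed
  then have "k * (card (verts H) - 1) \<le> (\<Sum>T\<in>\<T>. card T)"
    using sum_bounded_below[of \<T> "card (verts H) - 1" card] card by simp
  also have "\<dots> = card (\<Union>\<T>)"
  proof (rule card_Union_disjoint[symmetric])
    show "pairwise disjnt \<T>"
      using disj by (simp add: disjoint_def pairwise_def disjnt_def)
    show "finite T" if "T \<in> \<T>" for T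
      using that sub fin by (meson Sup_upper finite_subset order_trans)
  qed
  finally show "card ?G \<le> card (\<Union>\<T>)"
    using crit card_assigned[OF F] by (simp add: critical_def)
qed

end

lemma ordered_tree_decomposition_if_bij:
  assumes T: "spanning_tree_packing k V G \<T>" and "\<Union>\<T> = G" and bij: "bij_betw T {..<k} \<T>"
  shows "ordered_tree_decomposition k V G T"
proof -
  have "T i \<in> \<T>" if "i < k" for i
    using bij that by (auto simp: bij_betw_def)
  moreover have "T i \<inter> T j = {}" if "i < k" "j < k" "i \<noteq> j" for i j
  proof -
    have "T i \<noteq> T j"
      using bij that by (auto simp: bij_betw_def inj_on_def)
    then show ?thesis
      using T that calculation by (auto simp: spanning_tree_packing_def disjoint_def)
  qed
  moreover have "(\<Union>i<k. T i) = G"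
    using bij assms(2) by (simp add: bij_betw_def)
  ultimately show ?thesis
    using T by (auto simp: ordered_tree_decomposition_def spanning_tree_packing_def
        disjoint_family_on_def)
qed

theorem theorem2p6:
  fixes H :: "('v, 'e) multihypergraph"
    and F :: "'e \<Rightarrow> 'v set set"
    and k :: nat
  assumes "k \<ge> 1"
    and "labelled_multihypergraph H"
    and "weakly_partition_connected k H"
    and "tree_assignment H F"
  shows "(\<exists>\<T>. spanning_tree_packing k (verts H) (assigned_graph H F) \<T>) \<and>
    (critical k H \<longrightarrow>
      (\<forall>\<T>. spanning_tree_packing k (verts H) (assigned_graph H F) \<T> \<longrightarrow>
        \<Union>\<T> = assigned_graph H F \<and>
        (\<forall>T. bij_betw T {..<k} \<T> \<longrightarrow>
          ordered_tree_decomposition k (verts H) (assigned_graph H F) T)))"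
proof -
  interpret labelled_multihypergraph H
    by (rule assms(2))
  show ?thesis
  proof (intro conjI impI allI)
    show "\<exists>\<T>. spanning_tree_packing k (verts H) (assigned_graph H F) \<T>"
      using assms(3,4) by (rule exists_spanning_tree_packing)
    fix \<T> assume "critical k H" and \<T>: "spanning_tree_packing k (verts H) (assigned_graph H F) \<T>"
    then show un: "\<Union>\<T> = assigned_graph H F"
      using critical_packing_exhausts assms(4) by blast
    show "ordered_tree_decomposition k (verts H) (assigned_graph H F) T"
      if "bij_betw T {..<k} \<T>" for T
      using \<T> un that by (rule ordered_tree_decomposition_if_bij)
  qed
qed

end
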